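(* Assume that $m_i,u_i\in\mathbb{N}_0$, $d\in\mathbb{N}$, and $\bm s=\left(\textstyle\sqcup_{i=1}^{d-1}\{m_i+2,\{1\}_{u_i}\},m_d+2\right).$ If $a,p\in\mathbb{R}$ with $p\neq 1$ and $|a|\le \min\bigl(1,2/p-1\bigr)$ then \begin{align*} \operatorname{Li}^\star_{\bm s}\left(\{1\}_{\|\bm s\|-1},a\right) &=\operatorname{Li}^\star_{\{1\}_{|\bm s|}}\left(\textstyle\bigsqcup_{i=1}^{d-1}\bigl\{1-p,\{1\}_{m_i},\frac1{1-p},\{1\}_{u_i}\bigr\},1-p,\{1\}_{m_d},1+\tfrac{ap}{1-p}\right)\\ &\quad-\operatorname{Li}^\star_{\{1\}_{|\bm s|}}\left(\textstyle\bigsqcup_{i=1}^{d-1}\bigl\{1-p,\{1\}_{m_i},\frac1{1-p},\{1\}_{u_i}\bigr\},1-p,\{1\}_{m_d+1}\right). \end{align*}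
   Context: For $s_i\in\mathbb N$ and $x_i\in\mathbb R$, the multiple polylogarithm is $\operatorname{Li}^\star_{s_1,\dots,s_d}(x_1,\dots,x_d):=\sum_{n_1\ge\cdots\ge n_d\ge1}\prod_{i=1}^d x_i^{n_i}/n_i^{s_i}$. $\{1\}_r$ denotes $1$ repeated $r$ times, $\sqcup$ denotes concatenation of strings, $|\bm s|=s_1+\cdots+s_d$ is the sum of the components of $\bm s$, and $\|\bm s\|=\dim\bm s$ is the number of components. *)

theory Defs
  imports "HOL-Analysis.Analysis"
begin

definition weak_chains :: "nat \<Rightarrow> nat \<Rightarrow> nat list set" where
  "weak_chains k N = {ns. length ns = k \<and> sorted_wrt (\<ge>) ns \<and> set ns \<subseteq> {1..N}}"

lemma finite_weak_chains: "finite (weak_chains k N)"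
proof (rule finite_subset)
  show "weak_chains k N \<subseteq> {ns. set ns \<subseteq> {1..N} \<and> length ns = k}"
    by (auto simp: weak_chains_def)
  show "finite {ns. set ns \<subseteq> {1..N} \<and> length ns = k}"
    by (rule finite_lists_length_eq) simp
qed

definition Li_star_partial :: "nat list \<Rightarrow> real list \<Rightarrow> nat \<Rightarrow> real" where
  "Li_star_partial ss xs N =
     (\<Sum>ns\<in>weak_chains (length ss) N.
        \<Prod>i<length ss. (xs ! i) ^ (ns ! i) / real (ns ! i) ^ (ss ! i))"

text \<open>
  The infinite sum is the limit of the partial sums over \<open>n\<^sub>1 \<le> N\<close>, because the series need not
  converge absolutely (for instance when the first exponent is \<open>1\<close> and the first argument is
  \<open>- 1\<close>). A statement about \<open>Li_star\<close> is meaningful only where \<open>Li_star_converges\<close> holds.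
  Exponents and arguments are meant to be lists of the same length.
\<close>

definition Li_star_converges :: "nat list \<Rightarrow> real list \<Rightarrow> bool" where
  "Li_star_converges ss xs \<longleftrightarrow> convergent (Li_star_partial ss xs)"

definition Li_star :: "nat list \<Rightarrow> real list \<Rightarrow> real" where
  "Li_star ss xs = lim (Li_star_partial ss xs)"

end

theory Submission
  imports Defs "HOL-Real_Asymp.Real_Asymp"
begin

text \<open>
  Write \<open>S\<^bsub>c,x\<^esub> f N = (\<Sum>n=1..N. x ^ n / n ^ c * f n)\<close>; a partial sum of \<open>Li\<^sup>\<star>\<close> is an iterate of
  such operators applied to the constant \<open>1\<close>. The binomial mean
  \<open>E\<^sub>p f n = (\<Sum>k\<le>n. (n choose k) * p ^ k * (1 - p) ^ (n - k) * f k)\<close> commutes with \<open>S\<^bsub>1,1\<^esub>\<close>, turns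
  \<open>S\<^bsub>m+2,1\<^esub>\<close> into \<open>S\<^bsub>1,1-p\<^esub> S\<^bsub>1,1\<^esub>\<^sup>m S\<^bsub>1,1/(1-p)\<^esub>\<close>, and sends \<open>a ^ n\<close> to \<open>(1 - p + p * a) ^ n\<close>. Hence \<open>E\<^sub>p\<close> maps
  the partial sums of the left-hand side exactly to those of the right-hand side. For
  \<open>0 < p \<le> 1\<close> the mean \<open>E\<^sub>p\<close> preserves limits; for \<open>p > 1\<close> it does not, but
  \<open>E\<^bsub>1/p\<^esub> E\<^sub>p = id\<close>, so the limit can be carried from the right-hand side to the left-hand side.
  Convergence itself holds by absolute estimates when \<open>\<bar>1 - p\<bar> < 1\<close>, while \<open>p = 2\<close> (which forces
  \<open>a = 0\<close>) leads to alternating series.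
\<close>

section \<open>Star sums and the recursion for partial sums\<close>

definition star_sum :: "nat \<Rightarrow> real \<Rightarrow> (nat \<Rightarrow> real) \<Rightarrow> nat \<Rightarrow> real" where
  "star_sum c x f N = (\<Sum>n = 1..N. x ^ n / real n ^ c * f n)"

lemma star_sum_0 [simp]: "star_sum c x f 0 = 0"
  by (simp add: star_sum_def)

lemma star_sum_Suc:
  "star_sum c x f (Suc n) = star_sum c x f n + x ^ Suc n / real (Suc n) ^ c * f (Suc n)"
  by (simp add: star_sum_def)

lemma star_sum_diff:
  "star_sum c x (\<lambda>n. f n - g n) = (\<lambda>n. star_sum c x f n - star_sum c x g n)"
  by (rule ext) (simp add: star_sum_def right_diff_distrib sum_subtractf)

lemma funpow_star_sum_diff:
  "(star_sum c x ^^ k) (\<lambda>n. f n - g n) = (\<lambda>n. (star_sum c x ^^ k) f n - (star_sum c x ^^ k) g n)"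
  by (induction k) (simp_all add: star_sum_diff)

text \<open>Only the whole summand at \<open>n \<ge> 1\<close> matters, so factors can move between
  argument, exponent and function, and the value at \<open>0\<close> is free.\<close>

lemma star_sum_cong:
  "(\<And>n. n \<ge> 1 \<Longrightarrow> x ^ n / real n ^ c * f n = y ^ n / real n ^ c' * g n)
    \<Longrightarrow> star_sum c x f = star_sum c' y g"
  unfolding star_sum_def by (intro ext sum.cong) auto

lemma weak_chains_0: "weak_chains 0 N = {[]}"
  by (auto simp: weak_chains_def)

text \<open>The head of a weakly decreasing list bounds its tail, so the remaining indices range up
  to \<open>n\<close> instead of \<open>N\<close>; this makes partial sums iterates of
  \<open>star_sum\<close>.\<close>

lemma weak_chains_Suc:
  "weak_chains (Suc k) N = (\<lambda>(n, ns). n # ns) ` (SIGMA n:{1..N}. weak_chains k n)"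
proof (intro equalityI subsetI)
  fix xs assume "xs \<in> weak_chains (Suc k) N"
  then obtain n ns where "xs = n # ns" "length ns = k" "sorted_wrt (\<ge>) (n # ns)" "set (n # ns) \<subseteq> {1..N}"
    by (auto simp: weak_chains_def length_Suc_conv)
  then show "xs \<in> (\<lambda>(n, ns). n # ns) ` (SIGMA n:{1..N}. weak_chains k n)"
    by (force simp: weak_chains_def)
next
  fix xs assume "xs \<in> (\<lambda>(n, ns). n # ns) ` (SIGMA n:{1..N}. weak_chains k n)"
  then show "xs \<in> weak_chains (Suc k) N"
    by (fastforce simp: weak_chains_def)
qed

lemma Li_star_partial_Cons:
  "Li_star_partial (c # ss) (x # xs) = star_sum c x (Li_star_partial ss xs)"
proof
  fix N
  have inj: "inj_on (\<lambda>(n, ns). n # ns) (SIGMA n:{1..N}. weak_chains (length ss) n)"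
    by (auto simp: inj_on_def)
  show "Li_star_partial (c # ss) (x # xs) N = star_sum c x (Li_star_partial ss xs) N"
    unfolding Li_star_partial_def star_sum_def list.size add_0_right add_Suc_right
      weak_chains_Suc sum.reindex[OF inj] sum_distrib_left
    by (subst sum.Sigma)
       (simp_all add: finite_weak_chains case_prod_unfold prod.lessThan_Suc_shift
         del: prod.lessThan_Suc)
qed

lemma Li_star_partial_foldr:
  "Li_star_partial (map fst ps) (map snd ps) = foldr (\<lambda>(c, x). star_sum c x) ps (\<lambda>_. 1)"
proof (induction ps)
  case Nil
  show ?case by (simp add: Li_star_partial_def weak_chains_0 fun_eq_iff)
next
  case (Cons q ps)
  then show ?case by (cases q) (simp add: Li_star_partial_Cons)
qed

section \<open>Algebra of the binomial mean\<close>

text \<open>This is the transform of Euler summation; for \<open>0 \<le> p \<le> 1\<close> it is the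
  expectation of \<open>f\<close> under a binomial distribution.\<close>

definition binomial_mean :: "real \<Rightarrow> (nat \<Rightarrow> real) \<Rightarrow> nat \<Rightarrow> real" where
  "binomial_mean p f n = (\<Sum>k\<le>n. real (n choose k) * p ^ k * (1 - p) ^ (n - k) * f k)"

lemma binomial_mean_0 [simp]: "binomial_mean p f 0 = f 0"
  by (simp add: binomial_mean_def)

lemma binomial_mean_add:
  "binomial_mean p (\<lambda>k. f k + g k) n = binomial_mean p f n + binomial_mean p g n"
  by (simp add: binomial_mean_def algebra_simps sum.distrib)

lemma binomial_mean_diff:
  "binomial_mean p (\<lambda>k. f k - g k) n = binomial_mean p f n - binomial_mean p g n"
  by (simp add: binomial_mean_def algebra_simps sum_subtractf)

lemma binomial_mean_cmult:
  "binomial_mean p (\<lambda>k. c * f k) n = c * binomial_mean p f n"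
  by (simp add: binomial_mean_def sum_distrib_left algebra_simps)

text \<open>Pascal's rule. With T the shift of sequences, one step in \<open>n\<close> applies (1 -
  p) + pT, and the identities below follow by induction from this recursion.\<close>

lemma binomial_mean_Suc:
  "binomial_mean p f (Suc n) = (1 - p) * binomial_mean p f n + p * binomial_mean p (\<lambda>k. f (Suc k)) n"
proof -
  let ?q = "1 - p"
  have "binomial_mean p f (Suc n) = ?q ^ Suc n * f 0
      + (\<Sum>k\<le>n. real (Suc n choose Suc k) * p ^ Suc k * ?q ^ (n - k) * f (Suc k))"
    unfolding binomial_mean_def by (subst sum.atMost_Suc_shift) (simp del: binomial_Suc_Suc)
  also have "(\<Sum>k\<le>n. real (Suc n choose Suc k) * p ^ Suc k * ?q ^ (n - k) * f (Suc k))
      = (\<Sum>k\<le>n. real (n choose Suc k) * p ^ Suc k * ?q ^ (n - k) * f (Suc k))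
        + p * binomial_mean p (\<lambda>k. f (Suc k)) n"
    by (simp add: binomial_mean_def sum_distrib_left algebra_simps sum.distrib)
  also have "?q ^ Suc n * f 0
      + ((\<Sum>k\<le>n. real (n choose Suc k) * p ^ Suc k * ?q ^ (n - k) * f (Suc k))
        + p * binomial_mean p (\<lambda>k. f (Suc k)) n)
      = (\<Sum>k\<le>Suc n. real (n choose k) * p ^ k * ?q ^ (Suc n - k) * f k)
        + p * binomial_mean p (\<lambda>k. f (Suc k)) n"
    by (subst sum.atMost_Suc_shift) simp
  \<comment> \<open>The top term drops out because \<open>n choose Suc n\<close> is 0.\<close>
  also have "(\<Sum>k\<le>Suc n. real (n choose k) * p ^ k * ?q ^ (Suc n - k) * f k)
      = (\<Sum>k\<le>n. real (n choose k) * p ^ k * ?q ^ (Suc n - k) * f k)"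
    by simp
  also have "\<dots> = ?q * binomial_mean p f n"
    unfolding binomial_mean_def sum_distrib_left
    by (rule sum.cong) (auto simp: Suc_diff_le)
  finally show ?thesis .
qed

lemma binomial_mean_1 [simp]: "binomial_mean 1 f n = f n"
  by (induction n arbitrary: f) (simp_all add: binomial_mean_Suc)

lemma binomial_mean_power: "binomial_mean p (\<lambda>k. a ^ k) n = (1 - p + p * a) ^ n"
  by (induction n) (simp_all add: binomial_mean_Suc binomial_mean_cmult algebra_simps)

text \<open>In terms of the shift T, (1 - p) + p((1 - q) + qT) = (1 - pq) + pqT. In particular the
  means for \<open>p\<close> and \<open>1 / p\<close> are inverse to each other.\<close>

lemma binomial_mean_binomial_mean:
  "binomial_mean p (binomial_mean q f) n = binomial_mean (p * q) f n"
proof (induction n arbitrary: f)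
  case (Suc n)
  have *: "binomial_mean p (\<lambda>k. binomial_mean q f (Suc k)) n
      = (1 - q) * binomial_mean (p * q) f n + q * binomial_mean (p * q) (\<lambda>k. f (Suc k)) n"
    by (simp only: binomial_mean_Suc binomial_mean_add binomial_mean_cmult Suc)
  show ?case
    unfolding binomial_mean_Suc[of p "binomial_mean q f"] binomial_mean_Suc[of "p * q"] Suc *
    by (simp add: algebra_simps)
qed simp

text \<open>An operator form of the absorption identity k C(n+1, k) = (n+1) C(n, k-1).\<close>

lemma binomial_mean_of_nat_mult:
  "binomial_mean p (\<lambda>k. real k * f k) (Suc n)
    = real (Suc n) * p * binomial_mean p (\<lambda>k. f (Suc k)) n"
proof (induction n arbitrary: f)
  case 0
  show ?case by (simp add: binomial_mean_Suc)
next
  case (Suc n)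
  have "binomial_mean p (\<lambda>k. real k * f k) (Suc (Suc n))
      = (1 - p) * (real (Suc n) * p * binomial_mean p (\<lambda>k. f (Suc k)) n)
        + p * (binomial_mean p (\<lambda>k. real k * f (Suc k)) (Suc n)
               + binomial_mean p (\<lambda>k. f (Suc k)) (Suc n))"
    by (subst binomial_mean_Suc, subst Suc, subst binomial_mean_add[symmetric])
       (simp add: algebra_simps)
  also have "binomial_mean p (\<lambda>k. real k * f (Suc k)) (Suc n)
      = real (Suc n) * p * binomial_mean p (\<lambda>k. f (Suc (Suc k))) n"
    by (rule Suc)
  finally show ?case
    by (simp add: binomial_mean_Suc[of p "\<lambda>k. f (Suc k)"] algebra_simps)
qed

text \<open>Absorption applied to \<open>f k / real k\<close>. The hypothesis \<open>f 0 = 0\<close>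
  makes multiplying back by \<open>k\<close> correct at \<open>k = 0\<close>, where the quotient is
  0 by convention.\<close>

lemma binomial_mean_divide_Suc:
  assumes "f 0 = 0"
  shows "p * binomial_mean p (\<lambda>k. f (Suc k) / real (Suc k)) n = binomial_mean p f (Suc n) / real (Suc n)"
proof -
  have "(\<lambda>k. real k * (f k / real k)) = f"
    using assms by auto
  with binomial_mean_of_nat_mult[of p "\<lambda>k. f k / real k" n] show ?thesis
    by (simp add: field_simps)
qed

section \<open>Binomial means of star sums\<close>

text \<open>From \<open>n\<close> to \<open>Suc n\<close> the mean of a sequence grows by
  \<open>p\<close> times the mean of its increments, here \<open>f (Suc k) / real (Suc k)\<close>,
  which the preceding lemma evaluates.\<close>

lemma binomial_mean_star_sum_1:
  assumes "f 0 = 0"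
  shows "binomial_mean p (star_sum 1 1 f) = star_sum 1 1 (binomial_mean p f)"
proof
  fix n show "binomial_mean p (star_sum 1 1 f) n = star_sum 1 1 (binomial_mean p f) n"
  proof (induction n)
    case (Suc n)
    have "binomial_mean p (star_sum 1 1 f) (Suc n)
        = binomial_mean p (star_sum 1 1 f) n + p * binomial_mean p (\<lambda>k. f (Suc k) / real (Suc k)) n"
      by (simp add: binomial_mean_Suc star_sum_Suc binomial_mean_add algebra_simps)
    then show ?case
      using assms by (simp add: Suc star_sum_Suc binomial_mean_divide_Suc del: of_nat_Suc One_nat_def)
  qed simp
qed

text \<open>Division by \<open>(1 - p) ^ n\<close> turns the coefficient \<open>1 - p\<close> of the
  recursion into 1, so the recursion telescopes; each factor \<open>1 / k\<close> costs one
  summation.\<close>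

lemma binomial_mean_divide_power:
  assumes "f 0 = 0" "p \<noteq> 1"
  shows "(\<lambda>n. binomial_mean p (\<lambda>k. f k / real k ^ j) n / (1 - p) ^ n)
    = (star_sum 1 1 ^^ j) (\<lambda>n. binomial_mean p f n / (1 - p) ^ n)"
proof (induction j)
  case (Suc j)
  define g where "g = (\<lambda>k. f k / real k ^ j)"
  have g0: "g 0 = 0" using assms by (simp add: g_def)
  have "binomial_mean p (\<lambda>k. g k / real k) n / (1 - p) ^ n
      = star_sum 1 1 (\<lambda>n. binomial_mean p g n / (1 - p) ^ n) n" for n
  proof (induction n)
    case (Suc n)
    have "binomial_mean p (\<lambda>k. g k / real k) (Suc n)
       = (1 - p) * binomial_mean p (\<lambda>k. g k / real k) n + binomial_mean p g (Suc n) / real (Suc n)"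
      using binomial_mean_divide_Suc[of g p n] g0
      by (simp add: binomial_mean_Suc[of p "\<lambda>k. g k / real k"])
    then have "binomial_mean p (\<lambda>k. g k / real k) (Suc n) / (1 - p) ^ Suc n
       = binomial_mean p (\<lambda>k. g k / real k) n / (1 - p) ^ n
         + binomial_mean p g (Suc n) / real (Suc n) / (1 - p) ^ Suc n"
      using assms(2) by (simp add: add_divide_distrib)
    then show ?case
      by (simp add: Suc star_sum_Suc del: of_nat_Suc)
  qed (simp add: g0)
  then show ?case
    using Suc by (simp add: g_def fun_eq_iff power_Suc2 del: power_Suc)
qed simp

text \<open>One of the \<open>m + 2\<close> factors \<open>1 / k\<close> commutes with the mean, the
  other \<open>m + 1\<close> become rescaled summations. Undoing the rescaling leaves
  \<open>1 - p\<close> in the outermost sum and \<open>1 / (1 - p)\<close> in the innermost.\<close>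

lemma binomial_mean_star_sum:
  assumes "f 0 = 0" "p \<noteq> 1"
  shows "binomial_mean p (star_sum (m + 2) 1 f)
    = star_sum 1 (1 - p) ((star_sum 1 1 ^^ m) (star_sum 1 (1 / (1 - p)) (binomial_mean p f)))"
proof -
  define q where "q = 1 - p"
  have q: "q \<noteq> 0" using assms by (simp add: q_def)
  define g where "g = (\<lambda>k. f k / real k ^ Suc m)"
  have "star_sum (m + 2) 1 f = star_sum 1 1 g"
    by (rule star_sum_cong) (simp add: g_def)
  then have "binomial_mean p (star_sum (m + 2) 1 f) = star_sum 1 1 (binomial_mean p g)"
    using binomial_mean_star_sum_1[of g p] by (simp add: g_def)
  also have "\<dots> = star_sum 1 q (\<lambda>n. binomial_mean p g n / q ^ n)"
    by (rule star_sum_cong) (use q in simp)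
  also have "(\<lambda>n. binomial_mean p g n / q ^ n)
      = (star_sum 1 1 ^^ Suc m) (\<lambda>n. binomial_mean p f n / q ^ n)"
    unfolding g_def q_def using assms by (rule binomial_mean_divide_power)
  also have "\<dots> = (star_sum 1 1 ^^ m) (star_sum 1 1 (\<lambda>n. binomial_mean p f n / q ^ n))"
    by (simp add: funpow_swap1)
  also have "star_sum 1 1 (\<lambda>n. binomial_mean p f n / q ^ n) = star_sum 1 (1 / q) (binomial_mean p f)"
    by (rule star_sum_cong) (simp add: power_one_over)
  finally show ?thesis by (simp add: q_def)
qed

lemma funpow_star_sum_eq_0: "f 0 = 0 \<Longrightarrow> (star_sum c x ^^ k) f 0 = 0"
  by (cases k) simp_all

lemma binomial_mean_funpow_star_sum:
  assumes "f 0 = 0"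
  shows "binomial_mean p ((star_sum 1 1 ^^ k) f) = (star_sum 1 1 ^^ k) (binomial_mean p f)"
  using assms by (induction k) (simp_all add: binomial_mean_star_sum_1 funpow_star_sum_eq_0 del: One_nat_def)

text \<open>Subtracting \<open>0 ^ n\<close> from \<open>a ^ n\<close> changes nothing for
  \<open>n \<ge> 1\<close> but gives the value 0 at \<open>n = 0\<close> that the block identity
  requires. The mean of \<open>0 ^ n\<close> is \<open>(1 - p) ^ n\<close>, the source of the
  subtracted series.\<close>

lemma binomial_mean_star_sum_power:
  assumes "p \<noteq> 1"
  shows "binomial_mean p (star_sum (m + 2) a (\<lambda>_. 1))
    = (\<lambda>n. star_sum 1 (1 - p) ((star_sum 1 1 ^^ m) (star_sum 1 (1 + a * p / (1 - p)) (\<lambda>_. 1))) n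
        - star_sum 1 (1 - p) ((star_sum 1 1 ^^ m) (star_sum 1 1 (\<lambda>_. 1))) n)"
proof -
  define q where "q = 1 - p"
  have q: "q \<noteq> 0" using assms by (simp add: q_def)
  have b: "1 / q * (q + p * a) = 1 + a * p / q"
    using q by (simp add: field_simps)
  have "star_sum (m + 2) a (\<lambda>_. 1) = star_sum (m + 2) 1 (\<lambda>n. a ^ n - 0 ^ n)"
    by (rule star_sum_cong) simp
  then have "binomial_mean p (star_sum (m + 2) a (\<lambda>_. 1))
      = star_sum 1 q ((star_sum 1 1 ^^ m)
          (star_sum 1 (1 / q) (binomial_mean p (\<lambda>n. a ^ n - 0 ^ n))))"
    using binomial_mean_star_sum[of "\<lambda>n. a ^ n - 0 ^ n" p m] assms by (simp add: q_def)
  also have "binomial_mean p (\<lambda>n. a ^ n - 0 ^ n) = (\<lambda>n. (q + p * a) ^ n - q ^ n)"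
    unfolding q_def by (rule ext) (simp add: binomial_mean_diff binomial_mean_power del: power_0_left)
  also have "star_sum 1 (1 / q) (\<lambda>n. (q + p * a) ^ n - q ^ n)
      = (\<lambda>n. star_sum 1 (1 / q) (\<lambda>n. (q + p * a) ^ n) n - star_sum 1 (1 / q) (\<lambda>n. q ^ n) n)"
    by (rule star_sum_diff)
  also have "star_sum 1 (1 / q) (\<lambda>n. (q + p * a) ^ n) = star_sum 1 (1 + a * p / q) (\<lambda>_. 1)"
    by (rule star_sum_cong) (simp flip: b power_mult_distrib)
  also have "star_sum 1 (1 / q) (\<lambda>n. q ^ n) = star_sum 1 1 (\<lambda>_. 1)"
    by (rule star_sum_cong) (use q in \<open>simp add: power_one_over\<close>)
  finally show ?thesis
    unfolding q_def by (simp add: funpow_star_sum_diff star_sum_diff)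
qed

section \<open>Limits of binomial means\<close>

lemma tendsto_binomial_weight:
  assumes "0 < p" "p < (1::real)"
  shows "(\<lambda>n. real (n choose k) * p ^ k * (1 - p) ^ (n - k)) \<longlonglongrightarrow> 0"
proof (rule tendsto_0_le)
  define q where "q = 1 - p"
  have q: "0 < q" "q < 1" using assms by (auto simp: q_def)
  show "(\<lambda>n. real n ^ k * q ^ n) \<longlonglongrightarrow> 0"
    using q by real_asymp
  show "\<forall>\<^sub>F n in sequentially. norm (real (n choose k) * p ^ k * (1 - p) ^ (n - k))
      \<le> norm (real n ^ k * q ^ n) * ((p / q) ^ k)"
    using eventually_ge_at_top[of k]
  proof eventually_elim
    case (elim n)
    have "real (n choose k) \<le> real n ^ k"
      using binomial_le_pow[OF elim] by (metis of_nat_le_iff of_nat_power)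
    moreover have "q ^ (n - k) = q ^ n / q ^ k"
      using q elim by (simp add: power_diff)
    ultimately show ?case
      using assms q by (simp add: q_def[symmetric] power_divide divide_right_mono mult_right_mono)
  qed
qed

text \<open>Toeplitz's argument: the weights are nonnegative, sum to 1, and tend to 0 for each fixed
  \<open>k\<close> when \<open>p < 1\<close>, so any finite initial segment of \<open>f\<close>
  loses its influence.\<close>

lemma tendsto_binomial_mean:
  assumes p: "0 < p" "p \<le> 1" and f: "f \<longlonglongrightarrow> L"
  shows "binomial_mean p f \<longlonglongrightarrow> L"
proof (cases "p = 1")
  case True
  then have "binomial_mean p f = f" by auto
  with f show ?thesis by simp
next
  case False
  with p have p1: "p < 1" by simp
  define w where "w = (\<lambda>n k. real (n choose k) * p ^ k * (1 - p) ^ (n - k))"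
  have w_nonneg: "w n k \<ge> 0" for n k using p by (simp add: w_def)
  have w_sum: "(\<Sum>k\<le>n. w n k) = 1" for n
    using binomial_mean_power[of p 1 n] by (simp add: binomial_mean_def w_def)
  show ?thesis
  proof (rule LIMSEQ_I)
    fix e :: real assume e: "e > 0"
    obtain K where K: "\<And>k. k \<ge> K \<Longrightarrow> \<bar>f k - L\<bar> < e / 2"
      using LIMSEQ_D[OF f, of "e / 2"] e by auto
    have "(\<lambda>n. \<Sum>k<K. w n k * \<bar>f k - L\<bar>) \<longlonglongrightarrow> (\<Sum>k<K. 0 * \<bar>f k - L\<bar>)"
      unfolding w_def by (intro tendsto_intros tendsto_binomial_weight p p1)
    then obtain M where M: "\<And>n. n \<ge> M \<Longrightarrow> \<bar>\<Sum>k<K. w n k * \<bar>f k - L\<bar>\<bar> < e / 2"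
      using LIMSEQ_D[of _ 0 "e / 2"] e by fastforce
    have "\<bar>binomial_mean p f n - L\<bar> < e" if "n \<ge> M" "n \<ge> K" for n
    proof -
      have "binomial_mean p f n - L = (\<Sum>k\<le>n. w n k * f k) - (\<Sum>k\<le>n. w n k) * L"
        by (simp add: w_sum) (simp add: binomial_mean_def w_def)
      also have "\<dots> = (\<Sum>k\<le>n. w n k * (f k - L))"
        by (simp add: sum_distrib_right right_diff_distrib sum_subtractf)
      finally have "\<bar>binomial_mean p f n - L\<bar> \<le> (\<Sum>k\<le>n. w n k * \<bar>f k - L\<bar>)"
        using w_nonneg by (simp add: order.trans[OF sum_abs] abs_mult)
      also have "{..n} = {..<K} \<union> {K..n}" using that by auto
      also have "(\<Sum>k\<in>{..<K} \<union> {K..n}. w n k * \<bar>f k - L\<bar>)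
          = (\<Sum>k<K. w n k * \<bar>f k - L\<bar>) + (\<Sum>k=K..n. w n k * \<bar>f k - L\<bar>)"
        by (rule sum.union_disjoint) auto
      also have "(\<Sum>k=K..n. w n k * \<bar>f k - L\<bar>) \<le> (\<Sum>k=K..n. w n k * (e / 2))"
        using K w_nonneg by (intro sum_mono mult_left_mono) (auto intro: less_imp_le)
      also have "\<dots> \<le> (\<Sum>k\<le>n. w n k * (e / 2))"
        using e w_nonneg by (intro sum_mono2) auto
      also have "\<dots> = e / 2" by (simp add: w_sum flip: sum_distrib_right sum_divide_distrib)
      finally show ?thesis using M[OF that(1)] by linarith
    qed
    then show "\<exists>no. \<forall>n\<ge>no. norm (binomial_mean p f n - L) < e"
      by (intro exI[of _ "max M K"]) auto
  qed
qed

text \<open>The limit travels from \<open>f\<close> to its mean if \<open>p \<le> 1\<close>, and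
  from the mean back to \<open>f\<close> through \<open>1 / p\<close> otherwise.\<close>

lemma lim_binomial_mean:
  assumes p: "0 < p" and "convergent f" "convergent (binomial_mean p f)"
  shows "lim (binomial_mean p f) = lim f"
proof (cases "p \<le> 1")
  case True
  then show ?thesis
    using tendsto_binomial_mean[OF p True] assms(2) by (metis convergent_LIMSEQ_iff limI)
next
  case False
  have "binomial_mean (1 / p) (binomial_mean p f) = f"
    using p by (simp add: fun_eq_iff binomial_mean_binomial_mean)
  moreover have "binomial_mean (1 / p) (binomial_mean p f) \<longlonglongrightarrow> lim (binomial_mean p f)"
    by (rule tendsto_binomial_mean) (use p False assms(3) in \<open>simp_all add: convergent_LIMSEQ_iff\<close>)
  ultimately have "f \<longlonglongrightarrow> lim (binomial_mean p f)" by (simp only:)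
  then show ?thesis by (rule limI[symmetric])
qed

section \<open>Square-root growth and absolute convergence\<close>

text \<open>This growth class is closed under \<open>star_sum 1 1\<close>, yet division by
  \<open>n\<^sup>2\<close> makes its members summable. At \<open>n = 0\<close> the bound would force
  \<open>f 0 = 0\<close>.\<close>

definition sqrt_bounded :: "(nat \<Rightarrow> real) \<Rightarrow> bool" where
  "sqrt_bounded f \<longleftrightarrow> (\<exists>C. \<forall>n\<ge>1. \<bar>f n\<bar> \<le> C * sqrt (real n))"

lemma sqrt_boundedE:
  assumes "sqrt_bounded f"
  obtains C where "C \<ge> 0" "\<And>n. n \<ge> 1 \<Longrightarrow> \<bar>f n\<bar> \<le> C * sqrt (real n)"
proof -
  obtain C where C: "\<forall>n\<ge>1. \<bar>f n\<bar> \<le> C * sqrt (real n)"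
    using assms by (auto simp: sqrt_bounded_def)
  have "\<bar>f 1\<bar> \<le> C * sqrt (real 1)" using C by blast
  then have "C \<ge> 0" by simp
  with C that show thesis by blast
qed

lemma sqrt_bounded_of_bounded:
  assumes "\<And>n. n \<ge> 1 \<Longrightarrow> \<bar>f n\<bar> \<le> C"
  shows "sqrt_bounded f"
  unfolding sqrt_bounded_def
proof (intro exI allI impI)
  fix n :: nat assume n: "n \<ge> 1"
  have "\<bar>f n\<bar> \<le> C" using assms n by blast
  moreover have "C * 1 \<le> C * sqrt (real n)"
    using n assms[OF n] by (intro mult_left_mono) auto
  ultimately show "\<bar>f n\<bar> \<le> C * sqrt (real n)" by simp
qed

lemma convergent_imp_sqrt_bounded: "convergent f \<Longrightarrow> sqrt_bounded (f :: nat \<Rightarrow> real)"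
  by (drule convergent_imp_Bseq) (auto simp: Bseq_def intro: sqrt_bounded_of_bounded)

lemma sum_inverse_sqrt_le: "(\<Sum>k = 1..n. 1 / sqrt (real k)) \<le> 2 * sqrt (real n)"
proof (induction n)
  case (Suc n)
  define x where "x = sqrt (real n)"
  define y where "y = sqrt (real (Suc n))"
  have xy: "0 \<le> x" "x \<le> y" "y > 0" "y\<^sup>2 = x\<^sup>2 + 1"
    by (auto simp: x_def y_def)
  \<comment> \<open>Since \<open>y\<^sup>2 = x\<^sup>2 + 1\<close>, this square yields the induction
    step multiplied by \<open>y\<close>.\<close>
  have "(y - x)\<^sup>2 \<ge> 0" by simp
  then have "2 * x * y + 1 \<le> 2 * y * y"
    using xy(4) by (simp add: power2_eq_square algebra_simps)
  then have "2 * x + 1 / y \<le> 2 * y"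
    using xy(3) by (simp add: field_simps)
  then show ?case
    using Suc unfolding x_def y_def by simp
qed simp

lemma abs_divide_le_inverse_sqrt:
  assumes "\<bar>y\<bar> \<le> C * sqrt (real n)" "n \<ge> 1"
  shows "\<bar>y\<bar> / real n \<le> C * (1 / sqrt (real n))"
proof -
  have "\<bar>y\<bar> / real n \<le> C * sqrt (real n) / real n"
    using assms by (intro divide_right_mono) auto
  also have "\<dots> = C * (1 / sqrt (real n))"
    using assms(2) by (simp add: field_simps)
  finally show ?thesis .
qed

lemma sqrt_bounded_star_sum:
  assumes "sqrt_bounded f"
  shows "sqrt_bounded (star_sum 1 1 f)"
proof -
  obtain C where C: "C \<ge> 0" "\<And>n. n \<ge> 1 \<Longrightarrow> \<bar>f n\<bar> \<le> C * sqrt (real n)"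
    using sqrt_boundedE[OF assms] by blast
  have "\<bar>star_sum 1 1 f n\<bar> \<le> 2 * C * sqrt (real n)" for n
  proof -
    have "\<bar>star_sum 1 1 f n\<bar> \<le> (\<Sum>k = 1..n. \<bar>f k\<bar> / real k)"
      unfolding star_sum_def by (rule order.trans[OF sum_abs]) (simp add: abs_mult)
    also have "\<dots> \<le> (\<Sum>k = 1..n. C * (1 / sqrt (real k)))"
      using C by (intro sum_mono abs_divide_le_inverse_sqrt) auto
    also have "\<dots> \<le> C * (2 * sqrt (real n))"
      unfolding sum_distrib_left[symmetric] by (intro mult_left_mono sum_inverse_sqrt_le C)
    finally show ?thesis by simp
  qed
  then show ?thesis unfolding sqrt_bounded_def by blast
qed

lemma sqrt_bounded_funpow_star_sum:
  "sqrt_bounded f \<Longrightarrow> sqrt_bounded ((star_sum 1 1 ^^ k) f)"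
  by (induction k) (simp_all add: sqrt_bounded_star_sum del: One_nat_def)

text \<open>A single comparison series serves both exponents at least 2 and dual blocks with
  \<open>\<bar>q\<bar> < 1\<close>.\<close>

lemma convergent_star_sum:
  assumes "\<And>n. n \<ge> 1 \<Longrightarrow> \<bar>x ^ n / real n ^ c * f n\<bar> \<le> C * (real n powr (- (3 / 2)))"
  shows "convergent (star_sum c x f)"
proof -
  define g where "g = (\<lambda>n. if n = 0 then 0 else x ^ n / real n ^ c * f n)"
  have "summable (\<lambda>n. C * (real n powr (- (3 / 2))))"
    by (intro summable_mult) (simp add: summable_real_powr_iff)
  then have "summable g"
    by (rule summable_comparison_test'[where N = 1]) (use assms in \<open>auto simp: g_def\<close>)
  then have "convergent (\<lambda>n. \<Sum>k\<le>n. g k)"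
    using summable_iff_convergent' by blast
  moreover have "(\<Sum>k\<le>n. g k) = star_sum c x f n" for n
    unfolding star_sum_def g_def by (rule sum.mono_neutral_cong_right) auto
  ultimately show ?thesis by (simp add: fun_eq_iff)
qed

lemma powr_minus_three_halves:
  fixes x :: real
  assumes "x > 0"
  shows "x powr (- (3 / 2)) = 1 / (x * sqrt x)" "x powr (- (3 / 2)) = sqrt x / x\<^sup>2"
proof -
  have "x powr (3 / 2) = x powr 1 * x powr (1 / 2)"
    unfolding powr_add[symmetric] by simp
  also have "\<dots> = x * sqrt x"
    using assms by (simp add: powr_half_sqrt)
  finally show 1: "x powr (- (3 / 2)) = 1 / (x * sqrt x)"
    using powr_minus_divide[of x "3 / 2"] by simp
  show "x powr (- (3 / 2)) = sqrt x / x\<^sup>2"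
    unfolding 1 using assms by (simp add: field_simps power2_eq_square)
qed

lemma convergent_star_sum_ge2:
  assumes "sqrt_bounded f" "\<bar>x\<bar> \<le> 1"
  shows "convergent (star_sum (m + 2) x f)"
proof -
  obtain C where C: "C \<ge> 0" "\<And>n. n \<ge> 1 \<Longrightarrow> \<bar>f n\<bar> \<le> C * sqrt (real n)"
    using sqrt_boundedE[OF assms(1)] by blast
  show ?thesis
  proof (rule convergent_star_sum)
    fix n :: nat assume n: "n \<ge> 1"
    have "\<bar>x ^ n / real n ^ (m + 2) * f n\<bar> = \<bar>x\<bar> ^ n * \<bar>f n\<bar> / real n ^ (m + 2)"
      by (simp add: abs_mult power_abs)
    also have "\<dots> \<le> 1 * (C * sqrt (real n)) / real n ^ 2"
      using n assms(2) C by (intro frac_le mult_mono power_increasing) (auto simp: power_le_one)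
    also have "\<dots> = C * real n powr (- (3 / 2))"
      using n by (simp add: powr_minus_three_halves(2))
    finally show "\<bar>x ^ n / real n ^ (m + 2) * f n\<bar> \<le> C * real n powr (- (3 / 2))" .
  qed
qed

text \<open>With \<open>r > 1\<close> the last terms dominate: \<open>n \<le> k * (1 + (n - k))\<close> absorbs the factor \<open>1 / sqrt k\<close>.\<close>

lemma sum_geometric_sqrt_le:
  fixes r :: real
  assumes "r > 1"
  obtains D where "D \<ge> 0" "\<And>n. n \<ge> 1 \<Longrightarrow> (\<Sum>k = 1..n. r ^ k / sqrt (real k)) \<le> D * (r ^ n / sqrt (real n))"
proof
  \<comment> \<open>The derivative of the geometric series at \<open>1 / r\<close>; its sum is the
    constant \<open>D\<close>.\<close>
  define w where "w = (\<lambda>j. real (Suc j) * (1 / r) ^ j)"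
  have summable: "summable w"
    using geometric_deriv_sums[of "1 / r"] assms
    by (auto simp: sums_iff w_def)
  have w_nonneg: "w j \<ge> 0" for j using assms by (simp add: w_def)
  show "suminf w \<ge> 0" using summable w_nonneg by (rule suminf_nonneg)
  fix n :: nat assume n: "n \<ge> 1"
  have le: "r ^ k / sqrt (real k) \<le> w (n - k) * (r ^ n / sqrt (real n))" if k: "k \<in> {1..n}" for k
  proof -
    define j where "j = n - k"
    have nk: "n = k + j" "k \<ge> 1" using k by (auto simp: j_def)
    have "j \<le> k * j" using nk by simp
    then have "n \<le> k * Suc j" using nk(1) by simp
    then have "real n \<le> real k * real (Suc j)"
      by (metis of_nat_le_iff of_nat_mult)
    \<comment> \<open>The extra factor \<open>Suc j\<close> makes the square root explicit.\<close>
    also have "\<dots> \<le> real k * (real (Suc j))\<^sup>2"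
      by (intro mult_left_mono) (auto simp: power2_eq_square)
    finally have "sqrt (real n) \<le> sqrt (real k * (real (Suc j))\<^sup>2)" by (rule real_sqrt_le_mono)
    then have "sqrt (real n) \<le> sqrt (real k) * real (Suc j)"
      by (simp add: real_sqrt_mult del: of_nat_Suc)
    then have "r ^ k * sqrt (real n) \<le> r ^ k * (sqrt (real k) * real (Suc j))"
      using assms by (intro mult_left_mono) auto
    then have "r ^ k / sqrt (real k) \<le> real (Suc j) * r ^ k / sqrt (real n)"
      using nk by (simp add: field_simps del: of_nat_Suc of_nat_add)
    also have "real (Suc j) * r ^ k = w j * r ^ n"
      using assms nk by (simp add: w_def power_add power_one_over)
    finally show ?thesis by (simp add: j_def)
  qed
  have "(\<Sum>k = 1..n. r ^ k / sqrt (real k)) \<le> (\<Sum>k = 1..n. w (n - k)) * (r ^ n / sqrt (real n))"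
    unfolding sum_distrib_right using le by (rule sum_mono)
  also have "(\<Sum>k = 1..n. w (n - k)) = (\<Sum>j<n. w j)"
    by (rule sum.reindex_bij_witness[of _ "\<lambda>j. n - j" "\<lambda>k. n - k"]) auto
  also have "(\<Sum>j<n. w j) \<le> suminf w"
    using summable w_nonneg by (intro sum_le_suminf) auto
  finally show "(\<Sum>k = 1..n. r ^ k / sqrt (real k)) \<le> suminf w * (r ^ n / sqrt (real n))"
    using assms by (simp add: mult_right_mono divide_right_mono)
qed

text \<open>Summation preserves the order \<open>r ^ n / sqrt n\<close>. The bound is on the whole
  summand because the growth may come from the power of \<open>x\<close> or from
  \<open>f\<close>.\<close>

lemma star_sum_geometric_bound:
  assumes "r > 1" and f: "\<And>n. n \<ge> 1 \<Longrightarrow> \<bar>x ^ n / real n ^ c * f n\<bar> \<le> C * (r ^ n / sqrt (real n))"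
    and "C \<ge> 0"
  shows "\<exists>D\<ge>0. \<forall>n\<ge>1. \<bar>star_sum c x f n\<bar> \<le> D * (r ^ n / sqrt (real n))"
proof -
  obtain D where D: "D \<ge> 0"
    "\<And>n. n \<ge> 1 \<Longrightarrow> (\<Sum>k = 1..n. r ^ k / sqrt (real k)) \<le> D * (r ^ n / sqrt (real n))"
    using sum_geometric_sqrt_le[OF assms(1)] by blast
  have "\<bar>star_sum c x f n\<bar> \<le> (C * D) * (r ^ n / sqrt (real n))" if "n \<ge> 1" for n
  proof -
    have "\<bar>star_sum c x f n\<bar> \<le> (\<Sum>k = 1..n. C * (r ^ k / sqrt (real k)))"
      unfolding star_sum_def by (rule order.trans[OF sum_abs sum_mono]) (rule f, simp)
    also have "\<dots> \<le> C * (D * (r ^ n / sqrt (real n)))"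
      unfolding sum_distrib_left[symmetric] using D(2)[OF that] assms(3) by (rule mult_left_mono)
    finally show ?thesis by simp
  qed
  then show ?thesis using D(1) assms(3) by (intro exI[of _ "C * D"]) auto
qed

text \<open>The innermost sum has order at most \<open>r ^ n / sqrt n\<close> with
  \<open>r = 1 / \<bar>q\<bar>\<close>, and the middle sums keep it. The outer factor
  \<open>q ^ n / n\<close> cancels the geometric part and leaves the exponent -3/2.\<close>

lemma convergent_star_sum_block:
  assumes "sqrt_bounded f" "q \<noteq> 0" "\<bar>q\<bar> < 1"
  shows "convergent (star_sum 1 q ((star_sum 1 1 ^^ m) (star_sum 1 (1 / q) f)))"
proof -
  define r where "r = 1 / \<bar>q\<bar>"
  have r: "r > 1" using assms by (simp add: r_def)
  obtain C where C: "C \<ge> 0" "\<And>n. n \<ge> 1 \<Longrightarrow> \<bar>f n\<bar> \<le> C * sqrt (real n)"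
    using sqrt_boundedE[OF assms(1)] by blast
  have "\<exists>D\<ge>0. \<forall>n\<ge>1. \<bar>(star_sum 1 1 ^^ m) (star_sum 1 (1 / q) f) n\<bar> \<le> D * (r ^ n / sqrt (real n))"
  proof (induction m)
    case 0
    have "\<bar>(1 / q) ^ n / real n ^ 1 * f n\<bar> \<le> C * (r ^ n / sqrt (real n))" if "n \<ge> 1" for n
    proof -
      have "\<bar>(1 / q) ^ n / real n ^ 1 * f n\<bar> = r ^ n * (\<bar>f n\<bar> / real n)"
        by (simp add: abs_mult power_abs r_def)
      also have "\<dots> \<le> r ^ n * (C * (1 / sqrt (real n)))"
        using C that r by (intro mult_left_mono abs_divide_le_inverse_sqrt) auto
      finally show ?thesis by (simp add: algebra_simps)
    qed
    from star_sum_geometric_bound[OF r this C(1)] show ?case by simp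
  next
    case (Suc m)
    define g where "g = (star_sum 1 1 ^^ m) (star_sum 1 (1 / q) f)"
    obtain D where D: "D \<ge> 0" "\<And>n. n \<ge> 1 \<Longrightarrow> \<bar>g n\<bar> \<le> D * (r ^ n / sqrt (real n))"
      using Suc unfolding g_def by blast
    have "\<bar>1 ^ n / real n ^ 1 * g n\<bar> \<le> D * (r ^ n / sqrt (real n))" if "n \<ge> 1" for n
    proof -
      have "\<bar>1 ^ n / real n ^ 1 * g n\<bar> = \<bar>g n\<bar> / real n" by (simp add: abs_mult)
      also have "\<dots> \<le> \<bar>g n\<bar> / 1" using that by (intro divide_left_mono) auto
      finally show ?thesis using D(2)[OF that] by simp
    qed
    from star_sum_geometric_bound[OF r this D(1)] show ?case by (simp add: g_def)
  qed
  then obtain D where D: "D \<ge> 0"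
    "\<And>n. n \<ge> 1 \<Longrightarrow> \<bar>(star_sum 1 1 ^^ m) (star_sum 1 (1 / q) f) n\<bar> \<le> D * (r ^ n / sqrt (real n))"
    by blast
  show ?thesis
  proof (rule convergent_star_sum)
    fix n :: nat assume n: "n \<ge> 1"
    define g where "g = (star_sum 1 1 ^^ m) (star_sum 1 (1 / q) f)"
    have "\<bar>q ^ n / real n ^ 1 * g n\<bar> = \<bar>q\<bar> ^ n / real n * \<bar>g n\<bar>"
      by (simp add: abs_mult power_abs)
    also have "\<dots> \<le> \<bar>q\<bar> ^ n / real n * (D * (r ^ n / sqrt (real n)))"
      using D(2)[OF n] unfolding g_def by (intro mult_left_mono) auto
    also have "\<dots> = D / (real n * sqrt (real n))"
      using assms by (simp add: r_def power_one_over)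
    also have "\<dots> = D * real n powr (- (3 / 2))"
      using n by (simp add: powr_minus_three_halves(1))
    finally show "\<bar>q ^ n / real n ^ 1 * (star_sum 1 1 ^^ m) (star_sum 1 (1 / q) f) n\<bar>
        \<le> D * real n powr (- (3 / 2))"
      by (simp add: g_def)
  qed
qed

section \<open>Alternating series for \<open>q = - 1\<close>\<close>

text \<open>These two bounds are what summation by parts uses: \<open>f n / n\<close> tends to 0 and
  has absolutely summable differences.\<close>

definition slowly_varying :: "(nat \<Rightarrow> real) \<Rightarrow> bool" where
  "slowly_varying f \<longleftrightarrow> (\<exists>C. \<forall>n\<ge>1. \<bar>f n\<bar> \<le> C * sqrt (real n) \<and> \<bar>f (Suc n) - f n\<bar> \<le> C / sqrt (real n))"

lemma slowly_varying_imp_sqrt_bounded: "slowly_varying f \<Longrightarrow> sqrt_bounded f"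
  unfolding slowly_varying_def sqrt_bounded_def by blast

text \<open>The increments have modulus \<open>\<bar>f (Suc n)\<bar> / real (Suc n)\<close>, so
  growth of \<open>f\<close> controls them. Growth of the sum itself comes from a direct estimate if
  \<open>x = 1\<close> and from convergence if \<open>x = - 1\<close>.\<close>

lemma slowly_varying_star_sum:
  assumes "sqrt_bounded f" "sqrt_bounded (star_sum 1 x f)" "\<bar>x\<bar> = 1"
  shows "slowly_varying (star_sum 1 x f)"
proof -
  obtain C where C: "C \<ge> 0" "\<And>n. n \<ge> 1 \<Longrightarrow> \<bar>f n\<bar> \<le> C * sqrt (real n)"
    using sqrt_boundedE[OF assms(1)] by blast
  obtain D where D: "D \<ge> 0" "\<And>n. n \<ge> 1 \<Longrightarrow> \<bar>star_sum 1 x f n\<bar> \<le> D * sqrt (real n)"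
    using sqrt_boundedE[OF assms(2)] by blast
  show ?thesis unfolding slowly_varying_def
  proof (intro exI[of _ "max C D"] allI impI conjI)
    fix n :: nat assume n: "n \<ge> 1"
    show "\<bar>star_sum 1 x f n\<bar> \<le> max C D * sqrt (real n)"
      using D(2)[OF n] by (rule order.trans) (simp add: mult_right_mono)
    have "\<bar>star_sum 1 x f (Suc n) - star_sum 1 x f n\<bar> = \<bar>f (Suc n)\<bar> / real (Suc n)"
      using assms(3) by (simp add: star_sum_Suc abs_mult power_abs del: power_Suc)
    also have "\<dots> \<le> C * (1 / sqrt (real (Suc n)))"
      by (intro abs_divide_le_inverse_sqrt C) auto
    also have "\<dots> \<le> max C D * (1 / sqrt (real n))"
      using n C by (intro mult_mono divide_left_mono) auto
    finally show "\<bar>star_sum 1 x f (Suc n) - star_sum 1 x f n\<bar> \<le> max C D / sqrt (real n)" by simp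
  qed
qed

lemma slowly_varying_star_sum_1: "sqrt_bounded f \<Longrightarrow> slowly_varying (star_sum 1 1 f)"
  by (rule slowly_varying_star_sum) (simp_all add: sqrt_bounded_star_sum del: One_nat_def)

lemma slowly_varying_funpow_star_sum:
  "slowly_varying f \<Longrightarrow> slowly_varying ((star_sum 1 1 ^^ k) f)"
  by (induction k)
    (simp_all add: slowly_varying_star_sum_1 slowly_varying_imp_sqrt_bounded del: One_nat_def)

text \<open>Summation by parts: twice the alternating sum of \<open>w k = f k / k\<close> is, up to a boundary term,
  the alternating sum of the differences of \<open>w\<close>, which converges absolutely.\<close>

lemma convergent_star_sum_alternating:
  assumes "slowly_varying f"
  shows "convergent (star_sum 1 (- 1) f)"
proof -
  obtain C where C: "\<And>n. n \<ge> 1 \<Longrightarrow> \<bar>f n\<bar> \<le> C * sqrt (real n)"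
      "\<And>n. n \<ge> 1 \<Longrightarrow> \<bar>f (Suc n) - f n\<bar> \<le> C / sqrt (real n)"
    using assms unfolding slowly_varying_def by blast
  have C0: "C \<ge> 0" using C(1)[of 1] by simp
  define w where "w = (\<lambda>n. f n / real n)"
  \<comment> \<open>Division by zero gives \<open>w 0 = 0\<close>, so there is no boundary term at
    the lower end.\<close>
  have parts: "2 * star_sum 1 (- 1) f n = (-1) ^ n * w n + (\<Sum>k<n. (-1) ^ Suc k * (w (Suc k) - w k))" for n
  proof (induction n)
    case (Suc n)
    have "star_sum 1 (- 1) f (Suc n) = star_sum 1 (- 1) f n + (- 1) ^ Suc n * w (Suc n)"
      by (simp add: star_sum_Suc w_def)
    then show ?case
      using Suc by (simp add: right_diff_distrib)
  qed (simp add: w_def)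
  have "w \<longlonglongrightarrow> 0"
  proof (rule Lim_null_comparison)
    show "\<forall>\<^sub>F n in sequentially. norm (w n) \<le> C * (1 / sqrt (real n))"
      using eventually_ge_at_top[of 1]
    proof eventually_elim
      case (elim n)
      then show ?case using abs_divide_le_inverse_sqrt[OF C(1)[OF elim] elim] by (simp add: w_def)
    qed
    show "(\<lambda>n. C * (1 / sqrt (real n))) \<longlonglongrightarrow> 0"
      by real_asymp
  qed
  then have 1: "(\<lambda>n. (-1) ^ n * w n) \<longlonglongrightarrow> 0"
    by (rule tendsto_0_le[where K = 1]) (simp add: abs_mult)
  have "summable (\<lambda>k. 2 * C * real k powr (- (3 / 2)))"
    by (intro summable_mult) (simp add: summable_real_powr_iff)
  then have "summable (\<lambda>k. (-1) ^ Suc k * (w (Suc k) - w k))"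
  proof (rule summable_comparison_test'[where N = 1])
    fix k :: nat assume k: "k \<ge> 1"
    \<comment> \<open>This separates the change of \<open>f\<close> from the change of
      \<open>1 / k\<close>; each part has order at most \<open>k powr (- (3 / 2))\<close>.\<close>
    have "w (Suc k) - w k = (f (Suc k) - f k) / real (Suc k) - f k / (real k * real (Suc k))"
    proof -
      have "y / (x * (1 + x)) = y / x - y / (1 + x)" if "x > 0" for x y :: real
        using that by (simp add: field_simps)
      from this[of "real k" "f k"] k show ?thesis
        by (simp add: w_def diff_divide_distrib)
    qed
    then have "\<bar>w (Suc k) - w k\<bar> \<le> \<bar>f (Suc k) - f k\<bar> / real (Suc k) + \<bar>f k\<bar> / (real k * real (Suc k))"
      using abs_triangle_ineq4[of "(f (Suc k) - f k) / real (Suc k)" "f k / (real k * real (Suc k))"]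
      by (simp add: abs_mult del: of_nat_Suc)
    also have "\<dots> \<le> (C / sqrt (real k)) / real k + (C * sqrt (real k)) / (real k * real k)"
      using k C C0 by (intro add_mono frac_le mult_left_mono) auto
    also have "\<dots> = 2 * C * (real k powr (- (3 / 2)))"
    proof -
      have "C / sqrt (real k) / real k = C * (1 / (real k * sqrt (real k)))"
        and "C * sqrt (real k) / (real k * real k) = C * (sqrt (real k) / (real k)\<^sup>2)"
        by (simp_all add: power2_eq_square mult.commute)
      with k show ?thesis
        by (simp only: powr_minus_three_halves[of "real k", symmetric])
    qed
    finally show "norm ((-1) ^ Suc k * (w (Suc k) - w k)) \<le> 2 * C * (real k powr (- (3 / 2)))"
      by (simp add: abs_mult)
  qed
  then have "convergent (\<lambda>n. \<Sum>k<n. (-1) ^ Suc k * (w (Suc k) - w k))"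
    by (simp add: summable_iff_convergent)
  then have "convergent (\<lambda>n. 1 / 2 * ((-1) ^ n * w n + (\<Sum>k<n. (-1) ^ Suc k * (w (Suc k) - w k))))"
    by (intro convergent_mult[OF convergent_const] convergent_add[OF convergentI[OF 1]])
  then show ?thesis unfolding parts[symmetric] by simp
qed

section \<open>Blocks, their duals and convergence\<close>

definition star_block :: "nat \<Rightarrow> nat \<Rightarrow> (nat \<Rightarrow> real) \<Rightarrow> nat \<Rightarrow> real" where
  "star_block m u f = star_sum (m + 2) 1 ((star_sum 1 1 ^^ u) f)"

text \<open>The image of \<open>star_block\<close> under the binomial mean when
  \<open>q = 1 - p\<close>; it encodes the argument string \<open>q\<close>, \<open>m\<close> ones,
  \<open>1 / q\<close>, \<open>u\<close> ones, all with exponent 1.\<close>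

definition dual_block :: "real \<Rightarrow> nat \<Rightarrow> nat \<Rightarrow> (nat \<Rightarrow> real) \<Rightarrow> nat \<Rightarrow> real" where
  "dual_block q m u f =
    star_sum 1 q ((star_sum 1 1 ^^ m) (star_sum 1 (1 / q) ((star_sum 1 1 ^^ u) f)))"

lemma dual_block_diff:
  "dual_block q m u (\<lambda>n. f n - g n) = (\<lambda>n. dual_block q m u f n - dual_block q m u g n)"
  by (simp add: dual_block_def star_sum_diff funpow_star_sum_diff)

lemma foldr_dual_block_diff:
  "foldr (\<lambda>i. dual_block q (m i) (u i)) xs (\<lambda>n. f n - g n)
    = (\<lambda>n. foldr (\<lambda>i. dual_block q (m i) (u i)) xs f n - foldr (\<lambda>i. dual_block q (m i) (u i)) xs g n)"
  by (induction xs) (simp_all add: dual_block_diff)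

lemma binomial_mean_star_block:
  assumes "f 0 = 0" "p \<noteq> 1"
  shows "binomial_mean p (star_block m u f) = dual_block (1 - p) m u (binomial_mean p f)"
  using assms
  by (simp add: star_block_def dual_block_def binomial_mean_star_sum funpow_star_sum_eq_0
      binomial_mean_funpow_star_sum del: One_nat_def add_2_eq_Suc')

lemma binomial_mean_foldr_star_block:
  assumes "f 0 = 0" "p \<noteq> 1"
  shows "binomial_mean p (foldr (\<lambda>i. star_block (m i) (u i)) xs f)
    = foldr (\<lambda>i. dual_block (1 - p) (m i) (u i)) xs (binomial_mean p f)"
proof (induction xs)
  case (Cons i xs)
  \<comment> \<open>Vanishing at 0 persists, because each added block is an empty sum there.\<close>
  have "foldr (\<lambda>i. star_block (m i) (u i)) xs f 0 = 0"
    using assms(1) by (cases xs) (simp_all add: star_block_def)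
  with Cons assms(2) show ?case by (simp add: binomial_mean_star_block)
qed simp

lemma convergent_foldr_star_block:
  assumes "convergent f"
  shows "convergent (foldr (\<lambda>i. star_block (m i) (u i)) xs f)"
proof (induction xs)
  case (Cons i xs)
  then have "convergent (star_block (m i) (u i) (foldr (\<lambda>i. star_block (m i) (u i)) xs f))"
    unfolding star_block_def[of "m i"]
    by (intro convergent_star_sum_ge2 sqrt_bounded_funpow_star_sum convergent_imp_sqrt_bounded) simp_all
  then show ?case by simp
qed (use assms in simp)

text \<open>Convergence implies boundedness, the growth bound needed to stay in the class;
  alternating sums can thus be iterated.\<close>

lemma star_sum_alternating:
  assumes "slowly_varying f"
  shows "convergent (star_sum 1 (- 1) f)" "slowly_varying (star_sum 1 (- 1) f)"
proof -
  show conv: "convergent (star_sum 1 (- 1) f)"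
    using assms by (rule convergent_star_sum_alternating)
  show "slowly_varying (star_sum 1 (- 1) f)"
    using slowly_varying_star_sum[OF slowly_varying_imp_sqrt_bounded[OF assms]
        convergent_imp_sqrt_bounded[OF conv]] by simp
qed

text \<open>For \<open>\<bar>q\<bar> < 1\<close>, convergence of the inner part supplies the growth
  bound for the next block. For \<open>q = - 1\<close> the induction also carries slow variation,
  which the next alternating sums require.\<close>

lemma convergent_foldr_dual_block:
  assumes q: "q \<noteq> 0" "\<bar>q\<bar> < 1 \<or> q = - 1"
    and f: "convergent f" "q = - 1 \<Longrightarrow> slowly_varying f"
  shows "convergent (foldr (\<lambda>i. dual_block q (m i) (u i)) xs f)"
proof -
  let ?F = "\<lambda>xs. foldr (\<lambda>i. dual_block q (m i) (u i)) xs f"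
  have "convergent (?F xs) \<and> (q = - 1 \<longrightarrow> slowly_varying (?F xs))"
  proof (induction xs)
    case (Cons i xs)
    show ?case
    proof (cases "q = - 1")
      case True
      then have "slowly_varying ((star_sum 1 1 ^^ m i) (star_sum 1 (- 1) ((star_sum 1 1 ^^ u i) (?F xs))))"
        using Cons by (intro slowly_varying_funpow_star_sum star_sum_alternating(2)) simp
      then show ?thesis
        using star_sum_alternating True by (simp add: dual_block_def[of _ "m i"] del: One_nat_def)
    next
      case False
      have "sqrt_bounded ((star_sum 1 1 ^^ u i) (?F xs))"
        using Cons by (intro sqrt_bounded_funpow_star_sum convergent_imp_sqrt_bounded) auto
      then show ?thesis
        using convergent_star_sum_block False q
        by (simp add: dual_block_def[of _ "m i"] del: One_nat_def)
    qed
  qed (use f in auto)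
  then show ?thesis by blast
qed

text \<open>For \<open>\<bar>q\<bar> < 1\<close> the innermost sum is rewritten with argument
  \<open>1 / q\<close> and the bounded sequence \<open>(b * q) ^ n\<close>, which gives it the shape
  of a dual block. For \<open>q = - 1\<close> the condition \<open>b = 1\<close> makes it a plain
  harmonic sum.\<close>

lemma convergent_dual_partial:
  assumes q: "q \<noteq> 0" "\<bar>q\<bar> < 1 \<or> q = - 1"
    and b: "\<bar>b * q\<bar> \<le> 1" "q = - 1 \<Longrightarrow> b = 1"
  shows "convergent (foldr (\<lambda>i. dual_block q (m i) (u i)) xs
    (star_sum 1 q ((star_sum 1 1 ^^ k) (star_sum 1 b (\<lambda>_. 1)))))"
proof (rule convergent_foldr_dual_block[OF q])
  let ?f = "star_sum 1 q ((star_sum 1 1 ^^ k) (star_sum 1 b (\<lambda>_. 1)))"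
  have alt: "slowly_varying ((star_sum 1 1 ^^ k) (star_sum 1 b (\<lambda>_. 1)))" if "q = - 1"
    using b(2)[OF that]
    by (simp add: slowly_varying_funpow_star_sum slowly_varying_star_sum_1
        sqrt_bounded_of_bounded[of _ 1] del: One_nat_def)
  show "slowly_varying ?f" if "q = - 1"
    using star_sum_alternating(2)[OF alt[OF that]] that by simp
  show "convergent ?f"
  proof (cases "q = - 1")
    case True
    then show ?thesis using star_sum_alternating(1)[OF alt] by simp
  next
    case False
    have "star_sum 1 b (\<lambda>_. 1) = star_sum 1 (1 / q) (\<lambda>n. (b * q) ^ n)"
      by (rule star_sum_cong) (use q(1) in \<open>simp add: power_mult_distrib power_one_over\<close>)
    moreover have "sqrt_bounded (\<lambda>n. (b * q) ^ n)"
      by (rule sqrt_bounded_of_bounded[of _ 1]) (use b(1) in \<open>simp add: power_abs power_le_one\<close>)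
    ultimately show ?thesis
      using convergent_star_sum_block False q by (simp del: One_nat_def)
  qed
qed

section \<open>Partial sums of both sides as compositions of blocks\<close>

lemma foldr_concat_map: "foldr h (concat (map g xs)) = foldr (\<lambda>i. foldr h (g i)) xs"
  by (induction xs) (simp_all add: foldr_append fun_eq_iff)

lemma Li_star_partial_star_blocks:
  fixes m u :: "nat \<Rightarrow> nat"
  assumes s: "s = concat (map (\<lambda>i. (m i + 2) # replicate (u i) 1) xs) @ [k + 2]"
  shows "Li_star_partial s (replicate (length s - 1) 1 @ [a])
    = foldr (\<lambda>i. star_block (m i) (u i)) xs (star_sum (k + 2) a (\<lambda>_. 1))"
proof -
  define ps :: "(nat \<times> real) list"
    where "ps = concat (map (\<lambda>i. (m i + 2, 1) # replicate (u i) (1, 1)) xs)"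
  have fst: "map fst (ps @ [(k + 2, a)]) = s"
    by (simp add: s ps_def map_concat comp_def)
  have "map snd ps = replicate (length ps) 1"
    by (rule replicate_eqI) (auto simp: ps_def)
  moreover have "length s = length ps + 1"
    unfolding fst[symmetric] by simp
  ultimately have snd: "map snd (ps @ [(k + 2, a)]) = replicate (length s - 1) 1 @ [a]"
    by simp
  show ?thesis
    using Li_star_partial_foldr[of "ps @ [(k + 2, a)]"] unfolding fst snd
    by (simp add: ps_def foldr_concat_map foldr_replicate star_block_def[abs_def] comp_def del: One_nat_def)
qed

lemma Li_star_partial_dual_blocks:
  fixes m u :: "nat \<Rightarrow> nat"
  assumes s: "s = concat (map (\<lambda>i. (m i + 2) # replicate (u i) 1) xs) @ [k + 2]"
    and P: "P = concat (map (\<lambda>i. [q] @ replicate (m i) 1 @ [1 / q] @ replicate (u i) 1) xs)"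
  shows "Li_star_partial (replicate (sum_list s) 1) (P @ [q] @ replicate k 1 @ [b])
    = foldr (\<lambda>i. dual_block q (m i) (u i)) xs
        (star_sum 1 q ((star_sum 1 1 ^^ k) (star_sum 1 b (\<lambda>_. 1))))"
proof -
  define ys where "ys = P @ [q] @ replicate k 1 @ [b]"
  \<comment> \<open>Each block adds \<open>m i + 2 + u i\<close> both to the weight of
    \<open>s\<close> and to the number of arguments; the last entry adds
    \<open>k + 2\<close>.\<close>
  have "length ys = sum_list s"
    unfolding ys_def s P by (induction xs) (simp_all add: sum_list_replicate)
  then have "map fst (map (Pair 1) ys) = replicate (sum_list s) (1::nat)"
    by (simp add: comp_def map_replicate_const)
  moreover have "map snd (map (Pair (1::nat)) ys) = ys"
    by (simp add: comp_def)
  ultimately have "Li_star_partial (replicate (sum_list s) 1) ys = foldr (star_sum 1) ys (\<lambda>_. 1)"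
    using Li_star_partial_foldr[of "map (Pair 1) ys"]
    by (simp add: foldr_map comp_def del: One_nat_def)
  then show ?thesis
    by (simp add: ys_def P foldr_concat_map foldr_replicate dual_block_def[abs_def] comp_def del: One_nat_def)
qed

text \<open>Convergence of all three series is part of the conclusion, since \<open>Li_star\<close>
  is a \<open>lim\<close> and only meaningful then.\<close>

theorem theorem3:
  fixes m u :: "nat \<Rightarrow> nat" and d :: nat and a p :: real
    and s :: "nat list" and P :: "real list"
  assumes "d \<ge> 1"
    and "s = concat (map (\<lambda>i. (m i + 2) # replicate (u i) 1) [1..<d]) @ [m d + 2]"
    and "P = concat (map (\<lambda>i. [1 - p] @ replicate (m i) 1 @ [1 / (1 - p)] @ replicate (u i) 1) [1..<d])"
    and "p \<noteq> 1"
    and "\<bar>a\<bar> \<le> min 1 (2 / p - 1)"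
  shows "Li_star_converges s (replicate (length s - 1) 1 @ [a])
    \<and> Li_star_converges (replicate (sum_list s) 1)
         (P @ [1 - p] @ replicate (m d) 1 @ [1 + a * p / (1 - p)])
    \<and> Li_star_converges (replicate (sum_list s) 1)
         (P @ [1 - p] @ replicate (m d + 1) 1)
    \<and> Li_star s (replicate (length s - 1) 1 @ [a]) =
        Li_star (replicate (sum_list s) 1)
          (P @ [1 - p] @ replicate (m d) 1 @ [1 + a * p / (1 - p)])
        - Li_star (replicate (sum_list s) 1)
            (P @ [1 - p] @ replicate (m d + 1) 1)"
proof -
  define q where "q = 1 - p"
  define b where "b = 1 + a * p / q"
  have q0: "q \<noteq> 0" using assms(4) by (simp add: q_def)
  have a: "\<bar>a\<bar> \<le> 1" and "\<bar>a\<bar> \<le> 2 / p - 1" using assms(5) by auto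
  then have "2 / p \<ge> 1" by linarith
  \<comment> \<open>With \<open>2 / 0 = 0\<close>, the bound \<open>2 / p \<ge> 1\<close> excludes
    \<open>p = 0\<close> as well as negative \<open>p\<close>.\<close>
  then have p: "p > 0" "p \<le> 2"
    by (auto simp: le_divide_eq split: if_splits)
  have ap: "\<bar>a\<bar> * p \<le> 2 - p"
    using \<open>\<bar>a\<bar> \<le> 2 / p - 1\<close> p by (simp add: field_simps)
  have q: "\<bar>q\<bar> < 1 \<or> q = - 1"
    using p by (auto simp: q_def)
  have q2: "b = 1" if "q = - 1"
    using ap that by (simp add: b_def q_def)
  have bq: "b * q = 1 - p + a * p"
  proof -
    have "b * q = q + a * p" using q0 by (simp add: b_def distrib_right)
    then show ?thesis by (simp add: q_def)
  qed
  \<comment> \<open>The bound \<open>2 / p - 1\<close> keeps \<open>b * q\<close> above -1, and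
    \<open>\<bar>a\<bar> \<le> 1\<close> keeps it below 1, endpoints included.\<close>
  have "\<bar>a * p\<bar> \<le> 2 - p" "a * p \<le> p"
    using ap a p by (auto simp: abs_mult mult_le_cancel_right1 intro: mult_right_le_one_le)
  then have b: "\<bar>b * q\<bar> \<le> 1"
    unfolding bq by linarith
  let ?D = "\<lambda>b. foldr (\<lambda>i. dual_block q (m i) (u i)) [1..<d]
        (star_sum 1 q ((star_sum 1 1 ^^ m d) (star_sum 1 b (\<lambda>_. 1))))"
  let ?X = "foldr (\<lambda>i. star_block (m i) (u i)) [1..<d] (star_sum (m d + 2) a (\<lambda>_. 1))"
  have X: "Li_star_partial s (replicate (length s - 1) 1 @ [a]) = ?X"
    using assms(2) by (rule Li_star_partial_star_blocks)
  have D: "Li_star_partial (replicate (sum_list s) 1) (P @ [1 - p] @ replicate (m d) 1 @ [c]) = ?D c" for c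
    using Li_star_partial_dual_blocks[OF assms(2,3)] by (simp add: q_def)
  \<comment> \<open>The subtracted series is the case \<open>c = 1\<close>, whose last argument
    joins the preceding ones.\<close>
  have D1: "Li_star_partial (replicate (sum_list s) 1) (P @ [1 - p] @ replicate (m d + 1) 1) = ?D 1"
    using D[of 1] by (simp add: replicate_append_same)
  have conv_X: "convergent ?X"
    by (intro convergent_foldr_star_block convergent_star_sum_ge2 sqrt_bounded_of_bounded[of _ 1] a) simp
  have conv_D: "convergent (?D b)" "convergent (?D 1)"
    using q0 q b q2 by (auto intro!: convergent_dual_partial simp del: One_nat_def)
  have mean: "binomial_mean p ?X = (\<lambda>n. ?D b n - ?D 1 n)"
    using assms(4)
    by (simp add: binomial_mean_foldr_star_block binomial_mean_star_sum_power b_def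
        foldr_dual_block_diff flip: q_def del: One_nat_def add_2_eq_Suc')
  have "convergent (binomial_mean p ?X)"
    unfolding mean using conv_D by (rule convergent_diff)
  then have "lim ?X = lim (binomial_mean p ?X)"
    using lim_binomial_mean[OF p(1) conv_X] by simp
  also have "\<dots> = lim (?D b) - lim (?D 1)"
    unfolding mean using conv_D by (intro limI tendsto_diff) (auto simp: convergent_LIMSEQ_iff)
  finally show ?thesis
    using conv_X conv_D X D[of b] D1
    by (simp add: Li_star_converges_def Li_star_def b_def q_def del: One_nat_def replicate.simps)
qed

end
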